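(* Let $\mathbb{H}^3=\{(\tilde x^1,\tilde x^2,\tilde x^3)\in\mathbb{R}^3:\tilde x^3>0\}$ carry the Kropina metric $\tilde F=\tilde\alpha^2/\tilde\beta$, where $\tilde\alpha=\frac{\sqrt{(d\tilde x^1)^2+(d\tilde x^2)^2+(d\tilde x^3)^2}}{\tilde x^3}$ is the hyperbolic metric and $\tilde\beta=\frac{b\,d\tilde x^3}{(\tilde x^3)^2}$ with $b\neq0$ a constant. Consider the surface (open cone) given by the immersion $$\varphi(x^1,x^2)=(f(x^1)\cos x^2,\ f(x^1)\sin x^2,\ x^1),\qquad f(x^1)=\tfrac1{\sqrt2}x^1+c,$$ with $c$ a real constant and $f$ positive, endowed with the induced Kropina metric $F=\varphi^*\tilde F$. Then the flag curvature is non-positive for all directions on the surface, and hence the surface has no forward conjugate points with respect to the given Kropina metric.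
   Context: A Kropina metric $\tilde\alpha^2/\tilde\beta$ ($\tilde\alpha$ Riemannian, $\tilde\beta$ a $1$-form) is a conic Finsler metric, defined on directions with $\tilde\beta>0$. The induced metric is $F(x,y)=\tilde F(\varphi(x),\varphi_*(y))$. With $g_{ij}=\frac12\frac{\partial^2F^2}{\partial y^i\partial y^j}$ and spray coefficients $G^i=\frac14g^{i\ell}\{[F^2]_{x^ky^\ell}y^k-[F^2]_{x^\ell}\}$, geodesics satisfy $\ddot x^i+2G^i(x,\dot x)=0$, the Riemann curvature is $R^i_k=2\frac{\partial G^i}{\partial x^k}-y^j\frac{\partial^2G^i}{\partial x^j\partial y^k}+2G^j\frac{\partial^2G^i}{\partial y^j\partial y^k}-\frac{\partial G^i}{\partial y^j}\frac{\partial G^j}{\partial y^k}$, $R_y(u)=R^i_ku^k\frac{\partial}{\partial x^i}$, and the flag curvature with pole $y$ of $P=\mathrm{span}\{y,u\}$ is $K=\frac{g_y(R_y(u),u)}{g_y(y,y)g_y(u,u)-g_y(y,u)^2}$. Forward conjugate points are conjugate points along forward geodesics of $F$, in the usual Finsler sense. *)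

theory Defs
  imports "HOL-Analysis.Analysis"
begin

section \<open>Conic Finsler metrics in coordinates\<close>

text \<open>
  A metric is a function \<open>F x y\<close> of a point \<open>x\<close> and a tangent vector \<open>y\<close>, both given in
  coordinates. It is meaningful only on an open set \<open>C\<close> of pairs \<open>(x, y)\<close> that is conic in \<open>y\<close>.
  The definitions below are used at points of \<open>C\<close> only; as \<open>C\<close> is open, the values of \<open>F\<close>
  elsewhere do not influence the derivatives.
\<close>

definition partial :: "'n::finite \<Rightarrow> (real^'n \<Rightarrow> real) \<Rightarrow> real^'n \<Rightarrow> real" where
  "partial i h x = deriv (\<lambda>t. h (x + t *\<^sub>R axis i 1)) 0"

type_synonym 'n metric = "real^'n \<Rightarrow> real^'n \<Rightarrow> real"

definition fundamental_tensor :: "'n::finite metric \<Rightarrow> real^'n \<Rightarrow> real^'n \<Rightarrow> real^'n^'n" where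
  "fundamental_tensor F x y =
     (\<chi> i j. 1/2 * partial i (\<lambda>v. partial j (\<lambda>w. (F x w)\<^sup>2) v) y)"

definition spray :: "'n::finite metric \<Rightarrow> real^'n \<Rightarrow> real^'n \<Rightarrow> real^'n" where
  "spray F x y = (\<chi> i. 1/4 * (\<Sum>l\<in>UNIV. matrix_inv (fundamental_tensor F x y) $ i $ l *
     ((\<Sum>k\<in>UNIV. partial l (\<lambda>v. partial k (\<lambda>z. (F z v)\<^sup>2) x) y * y $ k)
       - partial l (\<lambda>z. (F z y)\<^sup>2) x)))"

definition nonlinear_connection :: "'n::finite metric \<Rightarrow> real^'n \<Rightarrow> real^'n \<Rightarrow> real^'n^'n" where
  "nonlinear_connection F x y = (\<chi> i j. partial j (\<lambda>v. spray F x v $ i) y)"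

definition riemann_curvature :: "'n::finite metric \<Rightarrow> real^'n \<Rightarrow> real^'n \<Rightarrow> real^'n^'n" where
  "riemann_curvature F x y = (\<chi> i k.
       2 * partial k (\<lambda>z. spray F z y $ i) x
     - (\<Sum>j\<in>UNIV. y $ j * partial j (\<lambda>z. partial k (\<lambda>v. spray F z v $ i) y) x)
     + 2 * (\<Sum>j\<in>UNIV. spray F x y $ j * partial j (\<lambda>v. partial k (\<lambda>w. spray F x w $ i) v) y)
     - (\<Sum>j\<in>UNIV. partial j (\<lambda>v. spray F x v $ i) y * partial k (\<lambda>v. spray F x v $ j) y))"

definition finsler_inner :: "'n::finite metric \<Rightarrow> real^'n \<Rightarrow> real^'n \<Rightarrow> real^'n \<Rightarrow> real^'n \<Rightarrow> real" where
  "finsler_inner F x y u v = (\<Sum>i\<in>UNIV. \<Sum>j\<in>UNIV. fundamental_tensor F x y $ i $ j * u $ i * v $ j)"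

definition flag_curvature :: "'n::finite metric \<Rightarrow> real^'n \<Rightarrow> real^'n \<Rightarrow> real^'n \<Rightarrow> real" where
  "flag_curvature F x y u =
     finsler_inner F x y (riemann_curvature F x y *v u) u /
     (finsler_inner F x y y y * finsler_inner F x y u u - (finsler_inner F x y y u)\<^sup>2)"

section \<open>Geodesics and conjugate points\<close>

definition velocity :: "real set \<Rightarrow> (real \<Rightarrow> real^'n) \<Rightarrow> real \<Rightarrow> real^'n" where
  "velocity I \<gamma> t = vector_derivative \<gamma> (at t within I)"

definition geodesic_on ::
  "'n::finite metric \<Rightarrow> ((real^'n) \<times> (real^'n)) set \<Rightarrow> real set \<Rightarrow> (real \<Rightarrow> real^'n) \<Rightarrow> bool" where
  "geodesic_on F C I \<gamma> \<longleftrightarrow>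
     \<gamma> differentiable_on I \<and> velocity I \<gamma> differentiable_on I \<and>
     (\<forall>t\<in>I. (\<gamma> t, velocity I \<gamma> t) \<in> C \<and>
        velocity I (velocity I \<gamma>) t + 2 *\<^sub>R spray F (\<gamma> t) (velocity I \<gamma> t) = 0)"

text \<open>
  Covariant derivative along \<open>\<gamma>\<close> with reference vector the velocity of \<open>\<gamma>\<close>; along a geodesic the
  Chern, Berwald and Cartan connections all give this operator.
\<close>

definition cov_deriv_along ::
  "'n::finite metric \<Rightarrow> real set \<Rightarrow> (real \<Rightarrow> real^'n) \<Rightarrow> (real \<Rightarrow> real^'n) \<Rightarrow> real \<Rightarrow> real^'n" where
  "cov_deriv_along F I \<gamma> J t =
     vector_derivative J (at t within I) + nonlinear_connection F (\<gamma> t) (velocity I \<gamma> t) *v J t"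

definition jacobi_field_on ::
  "'n::finite metric \<Rightarrow> real set \<Rightarrow> (real \<Rightarrow> real^'n) \<Rightarrow> (real \<Rightarrow> real^'n) \<Rightarrow> bool" where
  "jacobi_field_on F I \<gamma> J \<longleftrightarrow>
     J differentiable_on I \<and> cov_deriv_along F I \<gamma> J differentiable_on I \<and>
     (\<forall>t\<in>I. cov_deriv_along F I \<gamma> (cov_deriv_along F I \<gamma> J) t
        + riemann_curvature F (\<gamma> t) (velocity I \<gamma> t) *v J t = 0)"

text \<open>
  \<open>q\<close> is a forward conjugate point of \<open>p\<close>: some geodesic leads forward from \<open>p\<close> to \<open>q\<close> and carries
  a Jacobi field that vanishes at both ends but not identically.
\<close>

definition forward_conjugate ::
  "'n::finite metric \<Rightarrow> ((real^'n) \<times> (real^'n)) set \<Rightarrow> real^'n \<Rightarrow> real^'n \<Rightarrow> bool" where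
  "forward_conjugate F C p q \<longleftrightarrow>
     (\<exists>\<gamma> a b J. a < b \<and> geodesic_on F C {a..b} \<gamma> \<and> \<gamma> a = p \<and> \<gamma> b = q \<and>
        jacobi_field_on F {a..b} \<gamma> J \<and> J a = 0 \<and> J b = 0 \<and> (\<exists>t\<in>{a..b}. J t \<noteq> 0))"

section \<open>Kropina metrics and induced metrics\<close>

definition kropina :: "(real^'n \<Rightarrow> real^'n \<Rightarrow> real) \<Rightarrow> (real^'n \<Rightarrow> real^'n \<Rightarrow> real) \<Rightarrow> 'n metric" where
  "kropina \<alpha> \<beta> x y = (\<alpha> x y)\<^sup>2 / \<beta> x y"

definition kropina_domain ::
  "(real^'n) set \<Rightarrow> (real^'n \<Rightarrow> real^'n \<Rightarrow> real) \<Rightarrow> ((real^'n) \<times> (real^'n)) set" where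
  "kropina_domain M \<beta> = {(x, y). x \<in> M \<and> \<beta> x y > 0}"

definition pullback ::
  "(real^'m \<Rightarrow> real^'n) \<Rightarrow> (real^'n \<Rightarrow> real^'n \<Rightarrow> real) \<Rightarrow> real^'m \<Rightarrow> real^'m \<Rightarrow> real" where
  "pullback \<phi> T x y = T (\<phi> x) (frechet_derivative \<phi> (at x) y)"

section \<open>The surface in hyperbolic space\<close>

definition hyp3 :: "(real^3) set" where
  "hyp3 = {x. x $ 3 > 0}"

definition hyp_alpha :: "real^3 \<Rightarrow> real^3 \<Rightarrow> real" where
  "hyp_alpha x y = sqrt ((y $ 1)\<^sup>2 + (y $ 2)\<^sup>2 + (y $ 3)\<^sup>2) / x $ 3"

definition hyp_beta :: "real \<Rightarrow> real^3 \<Rightarrow> real^3 \<Rightarrow> real" where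
  "hyp_beta b x y = b * y $ 3 / (x $ 3)\<^sup>2"

definition profile :: "real \<Rightarrow> real \<Rightarrow> real" where
  "profile c s = 1 / sqrt 2 * s + c"

definition cone_map :: "real \<Rightarrow> real^2 \<Rightarrow> real^3" where
  "cone_map c x =
     vector [profile c (x $ 1) * cos (x $ 2), profile c (x $ 1) * sin (x $ 2), x $ 1]"

text \<open>
  The parameter domain is the largest one on which the profile is positive and the surface lies in
  hyperbolic space. The angle ranges over the whole line, so curves in parameters are lifts of
  curves on the surface.
\<close>

definition cone_params :: "real \<Rightarrow> (real^2) set" where
  "cone_params c = {x. cone_map c x \<in> hyp3 \<and> profile c (x $ 1) > 0}"

definition cone_metric :: "real \<Rightarrow> real \<Rightarrow> 2 metric" where
  "cone_metric b c = pullback (cone_map c) (kropina hyp_alpha (hyp_beta b))"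

definition cone_domain :: "real \<Rightarrow> real \<Rightarrow> ((real^2) \<times> (real^2)) set" where
  "cone_domain b c = kropina_domain (cone_params c) (pullback (cone_map c) (hyp_beta b))"

end

theory Submission
  imports Defs
begin

text \<open>
  The conformal factor of the hyperbolic metric cancels in \<open>\<alpha>\<^sup>2 / \<beta>\<close>. Writing \<open>(p, q)\<close> for a
  tangent vector in the parameters and \<open>r = k s + c\<close> for the radius at height \<open>s\<close>, the induced
  metric is \<open>F = D / (b p)\<close> with \<open>D = a p\<^sup>2 + r\<^sup>2 q\<^sup>2\<close>, where \<open>k = 1 / sqrt 2\<close> and
  \<open>a = 1 + k\<^sup>2 = 3 / 2\<close>. It is rational in \<open>(s, p, q)\<close> and independent of the angle, so its spray
  and its curvature can be written down in closed form; the spray is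

  \<open>G\<^sup>1 = - k r p\<^sup>2 q\<^sup>2 / D\<close> and \<open>G\<^sup>2 = k a p\<^sup>3 q / (r D)\<close>.

  It can be found without inverting the fundamental tensor: since \<open>F\<close> does not involve the angle,
  the curves of stationary length satisfy \<open>r\<^sup>2 q / p = const\<close>; together with \<open>F = const\<close> this
  determines the acceleration of a geodesic as a function of its velocity. The curvature then satisfies

  \<open>g(R u, u) = - 6 a (k r q)\<^sup>2 / (b\<^sup>2 D) (p u\<^sub>2 - q u\<^sub>1)\<^sup>2\<close>

  (lemma \<open>curvature_form\<close>), and the denominator of the flag curvature is
  \<open>det g (p u\<^sub>2 - q u\<^sub>1)\<^sup>2\<close>. The quotient is \<open>- 3 a k\<^sup>2 b\<^sup>2 p\<^sup>6 q\<^sup>2 / D\<^sup>4 \<le> 0\<close>.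

  Conjugate points are excluded by the convexity argument of Cartan and Hadamard. Along a geodesic
  with Jacobi field \<open>J\<close>, the function \<open>E = g(J, J)\<close> has second derivative
  \<open>2 g(DJ, DJ) - 2 g(R J, J) \<ge> 0\<close>. If \<open>J\<close> vanishes at both ends then \<open>E \<le> 0\<close> in between by
  convexity, and \<open>J = 0\<close> because \<open>g\<close> is positive definite
  (lemma \<open>no_forward_conjugate_points_if_curvature_nonpos\<close>). Besides the sign of the curvature this
  needs that \<open>g\<close>, taken at the velocity, is parallel along geodesics (lemma
  \<open>finsler_inner_along_geodesic\<close>), which is again a rational identity in \<open>(s, p, q)\<close>.
\<close>

section \<open>Non-positive curvature excludes conjugate points\<close>

text \<open>
  Only one-sided derivatives are available at the ends of the interval, because geodesics and
  Jacobi fields are differentiated within it.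
\<close>
lemma convex_nonpos_if_ends_zero:
  fixes E H H' :: "real \<Rightarrow> real"
  assumes "a < b"
    and E: "\<And>t. t \<in> {a..b} \<Longrightarrow> (E has_real_derivative H t) (at t within {a..b})"
    and H: "\<And>t. t \<in> {a..b} \<Longrightarrow> (H has_real_derivative H' t) (at t within {a..b})"
    and H': "\<And>t. t \<in> {a..b} \<Longrightarrow> H' t \<ge> 0"
    and ends: "E a = 0" "E b = 0" and t: "t \<in> {a..b}"
  shows "E t \<le> 0"
proof (rule ccontr)
  assume "\<not> E t \<le> 0"
  then have pos: "E t > 0" and t': "a < t" "t < b"
    using t ends by (auto simp: order.order_iff_strict)
  have E': "(E has_derivative (*) (H s)) (at s within X)" if "s \<in> X" "X \<subseteq> {a..b}" for s X
    using E[of s] that has_derivative_subset[of E "(*) (H s)" s "{a..b}" X]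
    by (auto simp: has_field_derivative_def)
  \<comment> \<open>A positive value inside makes \<open>E\<close> rise before it and fall after it, but its slope \<open>H\<close> cannot decrease.\<close>
  obtain t1 where t1: "t1 \<in> {a<..<t}" "E t - E a = H t1 * (t - a)"
    using mvt_simple[OF t'(1), of E "\<lambda>s. (*) (H s)"] E' t' by (smt (verit) atLeastAtMost_iff subsetI)
  obtain t2 where t2: "t2 \<in> {t<..<b}" "E b - E t = H t2 * (b - t)"
    using mvt_simple[OF t'(2), of E "\<lambda>s. (*) (H s)"] E' t' by (smt (verit) atLeastAtMost_iff subsetI)
  have "H t1 * (t - a) > 0" "H t2 * (b - t) < 0"
    using t1(2) t2(2) pos ends by simp_all
  then have "H t1 > 0" "H t2 < 0"
    using t' by (auto simp: zero_less_mult_iff mult_less_0_iff)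
  have "t1 < t2" using t1 t2 by auto
  have "(H has_derivative (*) (H' s)) (at s within {t1..t2})" if "s \<in> {t1..t2}" for s
    using H[of s] that t1 t2
    by (auto simp: has_field_derivative_def intro!: has_derivative_subset[of _ _ _ "{a..b}"])
  then obtain s where s: "s \<in> {t1<..<t2}" "H t2 - H t1 = H' s * (t2 - t1)"
    using mvt_simple[OF \<open>t1 < t2\<close>, of H "\<lambda>s. (*) (H' s)"] by auto
  have "H' s * (t2 - t1) \<ge> 0"
    using s(1) t1(1) t2(1) H'[of s] by auto
  then show False using s(2) \<open>H t1 > 0\<close> \<open>H t2 < 0\<close> by linarith
qed

text \<open>
  The assumption \<open>compat\<close> is the product rule for \<open>g\<close> along geodesics. It holds for every
  regular Finsler metric; as a hypothesis it lets the argument run for metrics whose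
  connection is known explicitly.
\<close>
lemma no_forward_conjugate_points_if_curvature_nonpos:
  fixes F :: "'n::finite metric"
  assumes sym: "\<And>x y u v. (x, y) \<in> C \<Longrightarrow> finsler_inner F x y u v = finsler_inner F x y v u"
    and pos: "\<And>x y u. (x, y) \<in> C \<Longrightarrow> u \<noteq> 0 \<Longrightarrow> finsler_inner F x y u u > 0"
    and curv: "\<And>x y u. (x, y) \<in> C \<Longrightarrow> finsler_inner F x y (riemann_curvature F x y *v u) u \<le> 0"
    and compat: "\<And>\<gamma> a b X Y t. a < b \<Longrightarrow> geodesic_on F C {a..b} \<gamma> \<Longrightarrow> t \<in> {a..b} \<Longrightarrow>
      X differentiable_on {a..b} \<Longrightarrow> Y differentiable_on {a..b} \<Longrightarrow>
      ((\<lambda>t. finsler_inner F (\<gamma> t) (velocity {a..b} \<gamma> t) (X t) (Y t)) has_real_derivative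
        finsler_inner F (\<gamma> t) (velocity {a..b} \<gamma> t) (cov_deriv_along F {a..b} \<gamma> X t) (Y t)
        + finsler_inner F (\<gamma> t) (velocity {a..b} \<gamma> t) (X t) (cov_deriv_along F {a..b} \<gamma> Y t))
      (at t within {a..b})"
  shows "\<not> forward_conjugate F C p q"
proof
  assume "forward_conjugate F C p q"
  then obtain \<gamma> a b J where ab: "a < b" and geo: "geodesic_on F C {a..b} \<gamma>"
    and jac: "jacobi_field_on F {a..b} \<gamma> J" and ends: "J a = 0" "J b = 0"
    and ne: "\<exists>t\<in>{a..b}. J t \<noteq> 0"
    unfolding forward_conjugate_def by blast
  let ?g = "\<lambda>t. finsler_inner F (\<gamma> t) (velocity {a..b} \<gamma> t)"
  let ?R = "\<lambda>t. riemann_curvature F (\<gamma> t) (velocity {a..b} \<gamma> t)"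
  define DJ where "DJ = cov_deriv_along F {a..b} \<gamma> J"
  have inC: "(\<gamma> t, velocity {a..b} \<gamma> t) \<in> C" if "t \<in> {a..b}" for t
    using geo that by (auto simp: geodesic_on_def)
  have diff: "J differentiable_on {a..b}" "DJ differentiable_on {a..b}"
    using jac by (auto simp: jacobi_field_on_def DJ_def)
  have jacobi: "cov_deriv_along F {a..b} \<gamma> DJ t = - (?R t *v J t)" if "t \<in> {a..b}" for t
    using jac that by (auto simp: jacobi_field_on_def DJ_def eq_neg_iff_add_eq_0)
  have lin: "?g t (- u) v = - ?g t u v" for t u v
    by (simp add: finsler_inner_def sum_negf)
  have E: "((\<lambda>t. ?g t (J t) (J t)) has_real_derivative 2 * ?g t (DJ t) (J t)) (at t within {a..b})"
    if "t \<in> {a..b}" for t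
    using compat[OF ab geo that diff(1) diff(1)] sym[OF inC[OF that], of "J t" "DJ t"]
    by (simp add: DJ_def)
  have H: "((\<lambda>t. 2 * ?g t (DJ t) (J t)) has_real_derivative
      2 * (?g t (DJ t) (DJ t) - ?g t (?R t *v J t) (J t))) (at t within {a..b})"
    if "t \<in> {a..b}" for t
    using DERIV_cmult[OF compat[OF ab geo that diff(2) diff(1)], of 2] jacobi[OF that]
    by (simp add: DJ_def lin)
  have nonneg: "2 * (?g t (DJ t) (DJ t) - ?g t (?R t *v J t) (J t)) \<ge> 0" if "t \<in> {a..b}" for t
    using pos[OF inC[OF that], of "DJ t"] curv[OF inC[OF that], of "J t"]
    by (cases "DJ t = 0") (auto simp: finsler_inner_def)
  have "?g t (J t) (J t) \<le> 0" if "t \<in> {a..b}" for t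
    using convex_nonpos_if_ends_zero[OF ab E H nonneg _ _ that] ends by (auto simp: finsler_inner_def)
  then show False using ne pos[OF inC] by fastforce
qed

section \<open>Partial derivatives in coordinates\<close>

text \<open>
  A partial derivative depends on the function near the point only, so a formula that holds on an
  open set may be differentiated instead.
\<close>
lemma partial_eqI:
  fixes x :: "real^'n::finite"
  assumes "open S" "x \<in> S" "\<And>v. v \<in> S \<Longrightarrow> h v = h' v"
    and D: "((\<lambda>t. h' (x + t *\<^sub>R axis i 1)) has_real_derivative D) (at 0)"
  shows "partial i h x = D"
proof -
  let ?T = "(\<lambda>t. x + t *\<^sub>R axis i (1::real)) -` S"
  have "open ?T"
    by (intro open_vimage assms continuous_intros)
  moreover have "0 \<in> ?T" using assms by simp
  ultimately have "((\<lambda>t. h (x + t *\<^sub>R axis i 1)) has_real_derivative D) (at 0)"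
    using assms(3) by (auto intro!: has_field_derivative_transform_within_open[OF D])
  then show ?thesis
    unfolding partial_def by (rule DERIV_imp_deriv)
qed

lemma axis_2_simps [simp]:
  "(axis 1 t :: real^2) $ 1 = t" "(axis 1 t :: real^2) $ 2 = 0"
  "(axis 2 t :: real^2) $ 1 = 0" "(axis 2 t :: real^2) $ 2 = t"
  by (simp_all add: axis_def)

lemma partial_1I:
  fixes x :: "real^2"
  assumes "open S" "x \<in> S" "\<And>v. v \<in> S \<Longrightarrow> h v = \<phi> (v$1) (v$2)"
    and "((\<lambda>s. \<phi> s (x$2)) has_real_derivative D) (at (x$1))"
  shows "partial 1 h x = D"
proof (rule partial_eqI[OF assms(1-3)])
  show "((\<lambda>t. \<phi> ((x + t *\<^sub>R axis 1 1)$1) ((x + t *\<^sub>R axis 1 1)$2)) has_real_derivative D) (at 0)"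
    using assms(4) DERIV_shift[of "\<lambda>s. \<phi> s (x$2)" D 0 "x$1"] by (simp add: add.commute)
qed

lemma partial_2I:
  fixes x :: "real^2"
  assumes "open S" "x \<in> S" "\<And>v. v \<in> S \<Longrightarrow> h v = \<phi> (v$1) (v$2)"
    and "((\<lambda>s. \<phi> (x$1) s) has_real_derivative D) (at (x$2))"
  shows "partial 2 h x = D"
proof (rule partial_eqI[OF assms(1-3)])
  show "((\<lambda>t. \<phi> ((x + t *\<^sub>R axis 2 1)$1) ((x + t *\<^sub>R axis 2 1)$2)) has_real_derivative D) (at 0)"
    using assms(4) DERIV_shift[of "\<lambda>s. \<phi> (x$1) s" D 0 "x$2"] by (simp add: add.commute)
qed

lemma matrix_inv_mult_eqI:
  fixes A :: "real^'n::finite^'n"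
  assumes "det A \<noteq> 0" "A *v v = w"
  shows "matrix_inv A *v w = v"
proof -
  have "invertible A" using assms(1) by (simp add: invertible_det_nz)
  then have "matrix_inv A ** A = mat 1"
    unfolding invertible_def matrix_inv_def by (rule someI2_ex) blast
  then show ?thesis using assms(2) by (metis matrix_vector_mul_assoc matrix_vector_mul_lid)
qed

section \<open>Rotationally symmetric Kropina metrics on a cone\<close>

text \<open>
  The induced metric of the cone with radius \<open>k s + c\<close> at height \<open>s\<close>. The coefficient \<open>a\<close> is
  free: the curvature and the spray depend on it as on a parameter.
\<close>
locale kropina_cone =
  fixes F :: "2 metric" and C :: "((real^2) \<times> (real^2)) set" and a b k c :: real
  assumes open_C: "open C"
    and a_pos: "a > 0"
    and dom: "(x, y) \<in> C \<Longrightarrow> k * x$1 + c > 0 \<and> b * y$1 > 0"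
    and F_eq: "(x, y) \<in> C \<Longrightarrow> F x y = (a * (y$1)\<^sup>2 + (k * x$1 + c)\<^sup>2 * (y$2)\<^sup>2) / (b * y$1)"
begin

definition r :: "real \<Rightarrow> real" where "r s = k * s + c"

definition D :: "real \<Rightarrow> real \<Rightarrow> real \<Rightarrow> real" where "D s p q = a * p\<^sup>2 + (r s)\<^sup>2 * q\<^sup>2"

definition admissible :: "real \<Rightarrow> real \<Rightarrow> bool" where "admissible s p \<longleftrightarrow> r s > 0 \<and> b * p > 0"

lemma admissible_if_in_C: "(x, y) \<in> C \<Longrightarrow> admissible (x$1) (y$1)"
  using dom by (auto simp: admissible_def r_def)

lemma admissible_nonzero:
  assumes "admissible s p"
  shows "r s > 0" "r s \<noteq> 0" "b \<noteq> 0" "p \<noteq> 0" "D s p q > 0" "D s p q \<noteq> 0"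
proof -
  show "r s > 0" "r s \<noteq> 0" "b \<noteq> 0" and p: "p \<noteq> 0"
    using assms by (auto simp: admissible_def)
  have "a * p\<^sup>2 > 0" using p a_pos by simp
  then show "D s p q > 0" "D s p q \<noteq> 0"
    unfolding D_def by (smt (verit) mult_nonneg_nonneg zero_le_power2)+
qed

lemma r_deriv [derivative_intros]:
  assumes "(h has_real_derivative h') (at t within X)"
  shows "((\<lambda>t. r (h t)) has_real_derivative k * h') (at t within X)"
  unfolding r_def using DERIV_add[OF DERIV_cmult[OF assms] DERIV_const] by simp

lemma D_deriv [derivative_intros]:
  "((\<lambda>s. D s p q) has_real_derivative 2 * k * r s * q\<^sup>2) (at s)"
  "((\<lambda>p. D s p q) has_real_derivative 2 * a * p) (at p)"
  "((\<lambda>q. D s p q) has_real_derivative 2 * (r s)\<^sup>2 * q) (at q)"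
  unfolding D_def by (auto intro!: derivative_eq_intros)

lemma open_slices:
  "open {z. (z, y) \<in> C}" "open {v. (x, v) \<in> C}"
proof -
  have "{z. (z, y) \<in> C} = (\<lambda>z. (z, y)) -` C" "{v. (x, v) \<in> C} = Pair x -` C" by auto
  then show "open {z. (z, y) \<in> C}" "open {v. (x, v) \<in> C}"
    by (auto intro!: open_vimage[OF open_C] continuous_intros)
qed

text \<open>
  All functions to be differentiated depend on the point through its height only. Their partial
  derivatives thus reduce to derivatives of functions of three real variables: the height \<open>s\<close> and
  the components \<open>p\<close> and \<open>q\<close> of the tangent vector.
\<close>
lemma partial_rotsym:
  assumes "(x, y) \<in> C" "\<And>z v. (z, v) \<in> C \<Longrightarrow> h z v = H (z$1) (v$1) (v$2)"
  shows "((\<lambda>s. H s (y$1) (y$2)) has_real_derivative E) (at (x$1)) \<Longrightarrow> partial 1 (\<lambda>z. h z y) x = E"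
    and "partial 2 (\<lambda>z. h z y) x = 0"
    and "((\<lambda>p. H (x$1) p (y$2)) has_real_derivative E) (at (y$1)) \<Longrightarrow> partial 1 (h x) y = E"
    and "((\<lambda>q. H (x$1) (y$1) q) has_real_derivative E) (at (y$2)) \<Longrightarrow> partial 2 (h x) y = E"
  using assms
  by (intro partial_1I[OF open_slices(1)[of y], where \<phi> = "\<lambda>s _. H s (y$1) (y$2)"]
      partial_2I[OF open_slices(1)[of y], where \<phi> = "\<lambda>s _. H s (y$1) (y$2)"]
      partial_1I[OF open_slices(2)[of x], where \<phi> = "H (x$1)"]
      partial_2I[OF open_slices(2)[of x], where \<phi> = "H (x$1)"]; auto)+

section \<open>The rational functions of height and velocity\<close>

text \<open>
  \<open>L\<close> is \<open>F\<^sup>2\<close>. A lower index after an underscore denotes a partial derivative, as in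
  \<open>L_sp = \<partial>\<^sub>p \<partial>\<^sub>s L\<close>, and \<open>g11\<close>, \<open>g12\<close>, \<open>g22\<close> are the entries of the fundamental tensor.
\<close>
definition "L s p q = (D s p q)\<^sup>2 / (b * p)\<^sup>2"
definition "L_s s p q = 4 * k * r s * q\<^sup>2 * D s p q / (b * p)\<^sup>2"
definition "L_p s p q = 2 * D s p q * (2 * a * p\<^sup>2 - D s p q) / (b\<^sup>2 * p ^ 3)"
definition "L_q s p q = 4 * (r s)\<^sup>2 * q * D s p q / (b * p)\<^sup>2"
definition "g11 s p q = (a\<^sup>2 * p ^ 4 + 3 * r s ^ 4 * q ^ 4) / (b\<^sup>2 * p ^ 4)"
definition "g12 s p q = - 4 * r s ^ 4 * q ^ 3 / (b\<^sup>2 * p ^ 3)"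
definition "g22 s p q = (2 * a * (r s)\<^sup>2 * p\<^sup>2 + 6 * r s ^ 4 * q\<^sup>2) / (b * p)\<^sup>2"
definition "L_sp s p q = - 8 * k * r s ^ 3 * q ^ 4 / (b\<^sup>2 * p ^ 3)"
definition "L_sq s p q = 8 * k * r s * q * (a * p\<^sup>2 + 2 * (r s)\<^sup>2 * q\<^sup>2) / (b * p)\<^sup>2"

text \<open>
  The form \<open>D\<close> stays folded while denominators are cleared, so that it is recognised as a nonzero
  factor; it is expanded only in the resulting polynomial identity. The lemmas on \<open>G1\<close>, \<open>N11\<close> and
  their kin are proved in the same way.
\<close>
lemma L_deriv:
  assumes "admissible s p"
  shows "((\<lambda>s. L s p q) has_real_derivative L_s s p q) (at s)"
    and "((\<lambda>p. L s p q) has_real_derivative L_p s p q) (at p)"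
    and "((\<lambda>q. L s p q) has_real_derivative L_q s p q) (at q)"
    and "((\<lambda>p. L_s s p q) has_real_derivative L_sp s p q) (at p)"
    and "((\<lambda>q. L_s s p q) has_real_derivative L_sq s p q) (at q)"
    and "((\<lambda>p. L_p s p q) has_real_derivative 2 * g11 s p q) (at p)"
    and "((\<lambda>q. L_p s p q) has_real_derivative 2 * g12 s p q) (at q)"
    and "((\<lambda>p. L_q s p q) has_real_derivative 2 * g12 s p q) (at p)"
    and "((\<lambda>q. L_q s p q) has_real_derivative 2 * g22 s p q) (at q)"
  unfolding L_def L_s_def L_p_def L_q_def g11_def g12_def g22_def L_sp_def L_sq_def
  by (rule DERIV_cong, (rule derivative_eq_intros refl | (simp add: admissible_nonzero[OF assms]; fail))+,
    (simp add: admissible_nonzero[OF assms] divide_simps; (unfold D_def)?; algebra))+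

text \<open>
  \<open>G1\<close>, \<open>G2\<close> are the spray coefficients, obtained from the constancy of \<open>r\<^sup>2 q / p\<close> and of \<open>F\<close>
  along geodesics; \<open>Nij\<close> is the derivative of \<open>Gi\<close> in the direction of the \<open>j\<close>-th component of the
  tangent vector.
\<close>
definition "G1 s p q = - (k * r s * p\<^sup>2 * q\<^sup>2) / D s p q"
definition "G2 s p q = k * a * p ^ 3 * q / (r s * D s p q)"
definition "N11 s p q = - (2 * k * r s ^ 3 * p * q ^ 4) / (D s p q)\<^sup>2"
definition "N12 s p q = - (2 * k * a * r s * p ^ 4 * q) / (D s p q)\<^sup>2"
definition "N21 s p q = k * a * p\<^sup>2 * q * (a * p\<^sup>2 + 3 * (r s)\<^sup>2 * q\<^sup>2) / (r s * (D s p q)\<^sup>2)"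
definition "N22 s p q = k * a * p ^ 3 * (a * p\<^sup>2 - (r s)\<^sup>2 * q\<^sup>2) / (r s * (D s p q)\<^sup>2)"
definition "G1_s s p q = - (k\<^sup>2 * p\<^sup>2 * q\<^sup>2 * (a * p\<^sup>2 - (r s)\<^sup>2 * q\<^sup>2)) / (D s p q)\<^sup>2"
definition "G2_s s p q = - (k\<^sup>2 * a * p ^ 3 * q * (a * p\<^sup>2 + 3 * (r s)\<^sup>2 * q\<^sup>2)) / ((r s)\<^sup>2 * (D s p q)\<^sup>2)"

lemma G_deriv:
  assumes "admissible s p"
  shows "((\<lambda>s. G1 s p q) has_real_derivative G1_s s p q) (at s)"
    and "((\<lambda>p. G1 s p q) has_real_derivative N11 s p q) (at p)"
    and "((\<lambda>q. G1 s p q) has_real_derivative N12 s p q) (at q)"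
    and "((\<lambda>s. G2 s p q) has_real_derivative G2_s s p q) (at s)"
    and "((\<lambda>p. G2 s p q) has_real_derivative N21 s p q) (at p)"
    and "((\<lambda>q. G2 s p q) has_real_derivative N22 s p q) (at q)"
  unfolding G1_def G2_def G1_s_def G2_s_def N11_def N12_def N21_def N22_def
  by (rule DERIV_cong, (rule derivative_eq_intros refl | (simp add: admissible_nonzero[OF assms]; fail))+,
    (simp add: admissible_nonzero[OF assms] divide_simps; (unfold D_def)?; algebra))+

definition "N11_s s p q = - (2 * k\<^sup>2 * (r s)\<^sup>2 * p * q ^ 4 * (3 * a * p\<^sup>2 - (r s)\<^sup>2 * q\<^sup>2)) / (D s p q) ^ 3"
definition "N12_s s p q = - (2 * k\<^sup>2 * a * p ^ 4 * q * (a * p\<^sup>2 - 3 * (r s)\<^sup>2 * q\<^sup>2)) / (D s p q) ^ 3"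
definition "N21_s s p q = - (k\<^sup>2 * a * p\<^sup>2 * q * (a\<^sup>2 * p ^ 4 + 2 * a * p\<^sup>2 * (r s)\<^sup>2 * q\<^sup>2 + 9 * (r s) ^ 4 * q ^ 4))
  / ((r s)\<^sup>2 * (D s p q) ^ 3)"
definition "N22_s s p q = - (k\<^sup>2 * a * p ^ 3 * (a\<^sup>2 * p ^ 4 + 6 * a * p\<^sup>2 * (r s)\<^sup>2 * q\<^sup>2 - 3 * (r s) ^ 4 * q ^ 4))
  / ((r s)\<^sup>2 * (D s p q) ^ 3)"
definition "G1_pp s p q = - (2 * k * (r s) ^ 3 * q ^ 4 * ((r s)\<^sup>2 * q\<^sup>2 - 3 * a * p\<^sup>2)) / (D s p q) ^ 3"
definition "G1_pq s p q = - (8 * k * a * (r s) ^ 3 * p ^ 3 * q ^ 3) / (D s p q) ^ 3"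
definition "G1_qq s p q = - (2 * k * a * r s * p ^ 4 * (a * p\<^sup>2 - 3 * (r s)\<^sup>2 * q\<^sup>2)) / (D s p q) ^ 3"
definition "G2_pp s p q = 2 * k * a * r s * p * q ^ 3 * (3 * (r s)\<^sup>2 * q\<^sup>2 - a * p\<^sup>2) / (D s p q) ^ 3"
definition "G2_pq s p q = k * a * p\<^sup>2 * (a\<^sup>2 * p ^ 4 + 6 * a * p\<^sup>2 * (r s)\<^sup>2 * q\<^sup>2 - 3 * (r s) ^ 4 * q ^ 4)
  / (r s * (D s p q) ^ 3)"
definition "G2_qq s p q = - (2 * k * a * r s * p ^ 3 * q * (3 * a * p\<^sup>2 - (r s)\<^sup>2 * q\<^sup>2)) / (D s p q) ^ 3"

lemma N_deriv:
  assumes "admissible s p"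
  shows "((\<lambda>s. N11 s p q) has_real_derivative N11_s s p q) (at s)"
    and "((\<lambda>s. N12 s p q) has_real_derivative N12_s s p q) (at s)"
    and "((\<lambda>s. N21 s p q) has_real_derivative N21_s s p q) (at s)"
    and "((\<lambda>s. N22 s p q) has_real_derivative N22_s s p q) (at s)"
    and "((\<lambda>p. N11 s p q) has_real_derivative G1_pp s p q) (at p)"
    and "((\<lambda>q. N11 s p q) has_real_derivative G1_pq s p q) (at q)"
    and "((\<lambda>p. N12 s p q) has_real_derivative G1_pq s p q) (at p)"
    and "((\<lambda>q. N12 s p q) has_real_derivative G1_qq s p q) (at q)"
    and "((\<lambda>p. N21 s p q) has_real_derivative G2_pp s p q) (at p)"
    and "((\<lambda>q. N21 s p q) has_real_derivative G2_pq s p q) (at q)"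
    and "((\<lambda>p. N22 s p q) has_real_derivative G2_pq s p q) (at p)"
    and "((\<lambda>q. N22 s p q) has_real_derivative G2_qq s p q) (at q)"
  unfolding N11_s_def N12_s_def N21_s_def N22_s_def N11_def N12_def N21_def N22_def
    G1_pp_def G1_pq_def G1_qq_def G2_pp_def G2_pq_def G2_qq_def
  by (rule DERIV_cong, (rule derivative_eq_intros refl | (simp add: admissible_nonzero[OF assms]; fail))+,
    (simp add: admissible_nonzero[OF assms] divide_simps; (unfold D_def)?; algebra))+

definition "R11 s p q = - (6 * k\<^sup>2 * a * (r s)\<^sup>2 * p ^ 4 * q ^ 4) / (D s p q) ^ 3"
definition "R12 s p q = 6 * k\<^sup>2 * a * (r s)\<^sup>2 * p ^ 5 * q ^ 3 / (D s p q) ^ 3"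
definition "R21 s p q = 3 * k\<^sup>2 * a * p ^ 3 * q ^ 3 * (a * p\<^sup>2 - (r s)\<^sup>2 * q\<^sup>2) / (D s p q) ^ 3"
definition "R22 s p q = - (3 * k\<^sup>2 * a * p ^ 4 * q\<^sup>2 * (a * p\<^sup>2 - (r s)\<^sup>2 * q\<^sup>2)) / (D s p q) ^ 3"

text \<open>
  The coordinate formula of the Riemann curvature, with the two sums written out and the derivatives
  with respect to the angle, which are zero, left out.
\<close>
lemma curvature_from_spray:
  assumes "admissible s p"
  shows "2 * G1_s s p q - p * N11_s s p q + 2 * (G1 s p q * G1_pp s p q + G2 s p q * G1_pq s p q)
      - (N11 s p q * N11 s p q + N12 s p q * N21 s p q) = R11 s p q"
    and "- p * N12_s s p q + 2 * (G1 s p q * G1_pq s p q + G2 s p q * G1_qq s p q)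
      - (N11 s p q * N12 s p q + N12 s p q * N22 s p q) = R12 s p q"
    and "2 * G2_s s p q - p * N21_s s p q + 2 * (G1 s p q * G2_pp s p q + G2 s p q * G2_pq s p q)
      - (N21 s p q * N11 s p q + N22 s p q * N21 s p q) = R21 s p q"
    and "- p * N22_s s p q + 2 * (G1 s p q * G2_pq s p q + G2 s p q * G2_qq s p q)
      - (N21 s p q * N12 s p q + N22 s p q * N22 s p q) = R22 s p q"
  unfolding N11_s_def N12_s_def N21_s_def N22_s_def N11_def N12_def N21_def N22_def
    G1_pp_def G1_pq_def G1_qq_def G2_pp_def G2_pq_def G2_qq_def G1_def G2_def G1_s_def G2_s_def
    R11_def R12_def R21_def R22_def
  by (simp add: admissible_nonzero[OF assms] divide_simps; (unfold D_def)?; algebra)+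

text \<open>
  The definition of the spray multiplied by the fundamental tensor. Terms with a derivative in the
  direction of the angle vanish.
\<close>
lemma spray_equations:
  assumes "admissible s p"
  shows "4 * (g11 s p q * G1 s p q + g12 s p q * G2 s p q) = L_sp s p q * p - L_s s p q"
    and "4 * (g12 s p q * G1 s p q + g22 s p q * G2 s p q) = L_sq s p q * p"
  unfolding g11_def g12_def g22_def G1_def G2_def L_sp_def L_sq_def L_s_def
  by (simp add: admissible_nonzero[OF assms] divide_simps; (unfold D_def)?; algebra)+

lemma det_g:
  assumes "admissible s p"
  shows "g11 s p q * g22 s p q - g12 s p q * g12 s p q = 2 * (r s)\<^sup>2 * D s p q ^ 3 / (b ^ 4 * p ^ 6)"
  unfolding g11_def g12_def g22_def
  by (simp add: admissible_nonzero[OF assms] divide_simps; (unfold D_def)?; algebra)+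

text \<open>
  The metric compatibility of the connection along geodesics, entry by entry: if \<open>x\<close> is the height
  of a geodesic with velocity \<open>(u, v)\<close>, then \<open>g' = g N + (g N)\<^sup>T\<close>.
\<close>
lemma g_along_geodesic:
  assumes "admissible (x t) (u t)"
    and "(x has_real_derivative u t) (at t within I)"
    and "(u has_real_derivative - 2 * G1 (x t) (u t) (v t)) (at t within I)"
    and "(v has_real_derivative - 2 * G2 (x t) (u t) (v t)) (at t within I)"
  shows "((\<lambda>t. g11 (x t) (u t) (v t)) has_real_derivative
      2 * (g11 (x t) (u t) (v t) * N11 (x t) (u t) (v t) + g12 (x t) (u t) (v t) * N21 (x t) (u t) (v t)))
      (at t within I)"
   and "((\<lambda>t. g12 (x t) (u t) (v t)) has_real_derivative
      g11 (x t) (u t) (v t) * N12 (x t) (u t) (v t) + g12 (x t) (u t) (v t) * N22 (x t) (u t) (v t)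
      + (g12 (x t) (u t) (v t) * N11 (x t) (u t) (v t) + g22 (x t) (u t) (v t) * N21 (x t) (u t) (v t)))
      (at t within I)"
   and "((\<lambda>t. g22 (x t) (u t) (v t)) has_real_derivative
      2 * (g12 (x t) (u t) (v t) * N12 (x t) (u t) (v t) + g22 (x t) (u t) (v t) * N22 (x t) (u t) (v t)))
      (at t within I)"
  unfolding g11_def g12_def g22_def N11_def N12_def N21_def N22_def
  by (rule DERIV_cong, (rule assms(2-4) derivative_eq_intros refl | (simp add: admissible_nonzero[OF assms(1)]; fail))+,
    (unfold G1_def G2_def; simp add: admissible_nonzero[OF assms(1)] divide_simps; (unfold D_def)?; algebra))+

section \<open>Spray and curvature in closed form\<close>

lemma F_sq:
  assumes "(x, y) \<in> C"
  shows "(F x y)\<^sup>2 = L (x$1) (y$1) (y$2)"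
  by (simp add: F_eq[OF assms] L_def D_def r_def power_divide)

lemma F_sq_partial:
  assumes "(x, y) \<in> C"
  shows "partial 1 (\<lambda>z. (F z y)\<^sup>2) x = L_s (x$1) (y$1) (y$2)"
    and "partial 2 (\<lambda>z. (F z y)\<^sup>2) x = 0"
    and "partial 1 (\<lambda>v. (F x v)\<^sup>2) y = L_p (x$1) (y$1) (y$2)"
    and "partial 2 (\<lambda>v. (F x v)\<^sup>2) y = L_q (x$1) (y$1) (y$2)"
proof -
  note dm = admissible_if_in_C[OF assms]
  note P = partial_rotsym[of x y "\<lambda>z v. (F z v)\<^sup>2" L, OF assms F_sq]
  show "partial 1 (\<lambda>z. (F z y)\<^sup>2) x = L_s (x$1) (y$1) (y$2)" by (rule P(1)[OF _ L_deriv(1)[OF dm]])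
  show "partial 2 (\<lambda>z. (F z y)\<^sup>2) x = 0" by (rule P)
  show "partial 1 (\<lambda>v. (F x v)\<^sup>2) y = L_p (x$1) (y$1) (y$2)" by (rule P(3)[OF _ L_deriv(2)[OF dm]])
  show "partial 2 (\<lambda>v. (F x v)\<^sup>2) y = L_q (x$1) (y$1) (y$2)" by (rule P(4)[OF _ L_deriv(3)[OF dm]])
qed

lemma fundamental_tensor_eq:
  assumes "(x, y) \<in> C"
  shows "fundamental_tensor F x y $ 1 $ 1 = g11 (x$1) (y$1) (y$2)"
    and "fundamental_tensor F x y $ 1 $ 2 = g12 (x$1) (y$1) (y$2)"
    and "fundamental_tensor F x y $ 2 $ 1 = g12 (x$1) (y$1) (y$2)"
    and "fundamental_tensor F x y $ 2 $ 2 = g22 (x$1) (y$1) (y$2)"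
proof -
  note dm = admissible_if_in_C[OF assms]
  note P = partial_rotsym(3,4)[of x y "\<lambda>z. partial 1 (\<lambda>v. (F z v)\<^sup>2)" L_p, OF assms F_sq_partial(3)]
  note P' = partial_rotsym(3,4)[of x y "\<lambda>z. partial 2 (\<lambda>v. (F z v)\<^sup>2)" L_q, OF assms F_sq_partial(4)]
  show "fundamental_tensor F x y $ 1 $ 1 = g11 (x$1) (y$1) (y$2)"
    by (simp add: fundamental_tensor_def P(1)[OF _ L_deriv(6)[OF dm]])
  show "fundamental_tensor F x y $ 2 $ 1 = g12 (x$1) (y$1) (y$2)"
    by (simp add: fundamental_tensor_def P(2)[OF _ L_deriv(7)[OF dm]])
  show "fundamental_tensor F x y $ 1 $ 2 = g12 (x$1) (y$1) (y$2)"
    by (simp add: fundamental_tensor_def P'(1)[OF _ L_deriv(8)[OF dm]])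
  show "fundamental_tensor F x y $ 2 $ 2 = g22 (x$1) (y$1) (y$2)"
    by (simp add: fundamental_tensor_def P'(2)[OF _ L_deriv(9)[OF dm]])
qed

lemma spray_eq:
  assumes "(x, y) \<in> C"
  shows "spray F x y $ 1 = G1 (x$1) (y$1) (y$2)" "spray F x y $ 2 = G2 (x$1) (y$1) (y$2)"
proof -
  note dm = admissible_if_in_C[OF assms]
  let ?g = "fundamental_tensor F x y"
  define G where "G = (vector [G1 (x$1) (y$1) (y$2), G2 (x$1) (y$1) (y$2)] :: real^2)"
  define w where "w = (\<chi> l. 1/4 * ((\<Sum>k\<in>UNIV. partial l (\<lambda>v. partial k (\<lambda>z. (F z v)\<^sup>2) x) y * y $ k)
       - partial l (\<lambda>z. (F z y)\<^sup>2) x))"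
  have d: "det ?g \<noteq> 0"
    using det_g[OF dm, of "y$2"] admissible_nonzero[OF dm]
    by (simp add: det_2 fundamental_tensor_eq[OF assms])
  have "partial 1 (\<lambda>v. partial 1 (\<lambda>z. (F z v)\<^sup>2) x) y = L_sp (x$1) (y$1) (y$2)"
    "partial 2 (\<lambda>v. partial 1 (\<lambda>z. (F z v)\<^sup>2) x) y = L_sq (x$1) (y$1) (y$2)"
    using partial_rotsym(3,4)[of x y "\<lambda>x v. partial 1 (\<lambda>z. (F z v)\<^sup>2) x" L_s, OF assms F_sq_partial(1)]
      L_deriv(4,5)[OF dm] by auto
  moreover have "partial 1 (\<lambda>v. partial 2 (\<lambda>z. (F z v)\<^sup>2) x) y = 0"
    "partial 2 (\<lambda>v. partial 2 (\<lambda>z. (F z v)\<^sup>2) x) y = 0"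
    using partial_rotsym(3,4)[of x y "\<lambda>x v. partial 2 (\<lambda>z. (F z v)\<^sup>2) x" "\<lambda>_ _ _. 0", OF assms F_sq_partial(2)]
    by auto
  ultimately have "?g *v G = w"
    using spray_equations[OF dm, of "y$2"]
    by (simp add: vec_eq_iff forall_2 matrix_vector_mult_def sum_2 w_def G_def
        fundamental_tensor_eq[OF assms] F_sq_partial[OF assms])
  then have "matrix_inv ?g *v w = G" by (rule matrix_inv_mult_eqI[OF d])
  moreover have "spray F x y = matrix_inv ?g *v w"
    by (simp add: vec_eq_iff spray_def w_def matrix_vector_mult_def sum_2 field_simps)
  ultimately show "spray F x y $ 1 = G1 (x$1) (y$1) (y$2)" "spray F x y $ 2 = G2 (x$1) (y$1) (y$2)"
    by (simp_all add: G_def)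
qed

lemma spray_partial:
  assumes "(x, y) \<in> C"
  shows "partial 1 (\<lambda>z. spray F z y $ 1) x = G1_s (x$1) (y$1) (y$2)"
    and "partial 1 (\<lambda>z. spray F z y $ 2) x = G2_s (x$1) (y$1) (y$2)"
    and "partial 2 (\<lambda>z. spray F z y $ 1) x = 0"
    and "partial 2 (\<lambda>z. spray F z y $ 2) x = 0"
    and "partial 1 (\<lambda>v. spray F x v $ 1) y = N11 (x$1) (y$1) (y$2)"
    and "partial 2 (\<lambda>v. spray F x v $ 1) y = N12 (x$1) (y$1) (y$2)"
    and "partial 1 (\<lambda>v. spray F x v $ 2) y = N21 (x$1) (y$1) (y$2)"
    and "partial 2 (\<lambda>v. spray F x v $ 2) y = N22 (x$1) (y$1) (y$2)"
  using partial_rotsym[of x y "\<lambda>z v. spray F z v $ 1" G1, OF assms spray_eq(1)]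
    partial_rotsym[of x y "\<lambda>z v. spray F z v $ 2" G2, OF assms spray_eq(2)]
    G_deriv[OF admissible_if_in_C[OF assms]]
  by auto

lemma nonlinear_connection_eq:
  assumes "(x, y) \<in> C"
  shows "nonlinear_connection F x y $ 1 $ 1 = N11 (x$1) (y$1) (y$2)"
    and "nonlinear_connection F x y $ 1 $ 2 = N12 (x$1) (y$1) (y$2)"
    and "nonlinear_connection F x y $ 2 $ 1 = N21 (x$1) (y$1) (y$2)"
    and "nonlinear_connection F x y $ 2 $ 2 = N22 (x$1) (y$1) (y$2)"
  using spray_partial[OF assms] by (simp_all add: nonlinear_connection_def)

lemma riemann_curvature_eq:
  assumes "(x, y) \<in> C"
  shows "riemann_curvature F x y $ 1 $ 1 = R11 (x$1) (y$1) (y$2)"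
    and "riemann_curvature F x y $ 1 $ 2 = R12 (x$1) (y$1) (y$2)"
    and "riemann_curvature F x y $ 2 $ 1 = R21 (x$1) (y$1) (y$2)"
    and "riemann_curvature F x y $ 2 $ 2 = R22 (x$1) (y$1) (y$2)"
proof -
  note dm = admissible_if_in_C[OF assms]
  note P11 = partial_rotsym[of x y "\<lambda>z. partial 1 (\<lambda>v. spray F z v $ 1)" N11, OF assms spray_partial(5)]
  note P12 = partial_rotsym[of x y "\<lambda>z. partial 2 (\<lambda>v. spray F z v $ 1)" N12, OF assms spray_partial(6)]
  note P21 = partial_rotsym[of x y "\<lambda>z. partial 1 (\<lambda>v. spray F z v $ 2)" N21, OF assms spray_partial(7)]
  note P22 = partial_rotsym[of x y "\<lambda>z. partial 2 (\<lambda>v. spray F z v $ 2)" N22, OF assms spray_partial(8)]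
  note second_partials =
    P11(1)[OF _ N_deriv(1)[OF dm]] P11(2) P11(3)[OF _ N_deriv(5)[OF dm]] P11(4)[OF _ N_deriv(6)[OF dm]]
    P12(1)[OF _ N_deriv(2)[OF dm]] P12(2) P12(3)[OF _ N_deriv(7)[OF dm]] P12(4)[OF _ N_deriv(8)[OF dm]]
    P21(1)[OF _ N_deriv(3)[OF dm]] P21(2) P21(3)[OF _ N_deriv(9)[OF dm]] P21(4)[OF _ N_deriv(10)[OF dm]]
    P22(1)[OF _ N_deriv(4)[OF dm]] P22(2) P22(3)[OF _ N_deriv(11)[OF dm]] P22(4)[OF _ N_deriv(12)[OF dm]]
  note simps = riemann_curvature_def sum_2 spray_partial[OF assms] spray_eq[OF assms] second_partials
  show "riemann_curvature F x y $ 1 $ 1 = R11 (x$1) (y$1) (y$2)"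
    using curvature_from_spray(1)[OF dm, of "y$2"] by (simp add: simps)
  show "riemann_curvature F x y $ 1 $ 2 = R12 (x$1) (y$1) (y$2)"
    using curvature_from_spray(2)[OF dm, of "y$2"] by (simp add: simps)
  show "riemann_curvature F x y $ 2 $ 1 = R21 (x$1) (y$1) (y$2)"
    using curvature_from_spray(3)[OF dm, of "y$2"] by (simp add: simps)
  show "riemann_curvature F x y $ 2 $ 2 = R22 (x$1) (y$1) (y$2)"
    using curvature_from_spray(4)[OF dm, of "y$2"] by (simp add: simps)
qed

section \<open>Positivity of the metric and sign of the curvature\<close>

lemma finsler_inner_eq:
  assumes "(x, y) \<in> C"
  shows "finsler_inner F x y u v = g11 (x$1) (y$1) (y$2) * u$1 * v$1
    + g12 (x$1) (y$1) (y$2) * (u$1 * v$2 + u$2 * v$1) + g22 (x$1) (y$1) (y$2) * u$2 * v$2"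
  by (simp add: finsler_inner_def sum_2 fundamental_tensor_eq[OF assms] algebra_simps)

lemma g11_pos: "admissible s p \<Longrightarrow> g11 s p q > 0"
  using a_pos admissible_nonzero[of s p] unfolding g11_def
  by (intro divide_pos_pos add_pos_nonneg mult_pos_pos mult_nonneg_nonneg) (auto simp: zero_less_power_eq)

lemma finsler_inner_complete_square:
  assumes "(x, y) \<in> C"
  shows "g11 (x$1) (y$1) (y$2) * finsler_inner F x y u u
    = (g11 (x$1) (y$1) (y$2) * u$1 + g12 (x$1) (y$1) (y$2) * u$2)\<^sup>2
      + 2 * (r (x$1))\<^sup>2 * D (x$1) (y$1) (y$2) ^ 3 / (b ^ 4 * (y$1) ^ 6) * (u$2)\<^sup>2"
  unfolding finsler_inner_eq[OF assms] det_g[OF admissible_if_in_C[OF assms], symmetric] by algebra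

lemma finsler_inner_pos:
  assumes "(x, y) \<in> C" "u \<noteq> 0"
  shows "finsler_inner F x y u u > 0"
proof -
  note dm = admissible_if_in_C[OF assms(1)]
  let ?d = "2 * (r (x$1))\<^sup>2 * D (x$1) (y$1) (y$2) ^ 3 / (b ^ 4 * (y$1) ^ 6)"
  have d: "?d > 0"
    using admissible_nonzero[OF dm] by (intro divide_pos_pos mult_pos_pos) (auto simp: zero_less_power_eq)
  have "g11 (x$1) (y$1) (y$2) * finsler_inner F x y u u > 0"
  proof (cases "u$2 = 0")
    case True
    then have "u$1 \<noteq> 0" using assms(2) by (simp add: vec_eq_iff forall_2)
    then show ?thesis
      unfolding finsler_inner_complete_square[OF assms(1)]
      using True g11_pos[OF dm, of "y$2"] by simp
  next
    case False
    then show ?thesis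
      unfolding finsler_inner_complete_square[OF assms(1)]
      using d by (intro add_nonneg_pos mult_pos_pos[OF d]) auto
  qed
  then show ?thesis using g11_pos[OF dm, of "y$2"] by (simp add: zero_less_mult_iff)
qed

text \<open>
  In dimension two the Gram determinant of \<open>y\<close> and \<open>u\<close> is \<open>det g\<close> times the square of their
  coordinate determinant.
\<close>
lemma cauchy_schwarz_deficit:
  assumes "(x, y) \<in> C"
  shows "finsler_inner F x y y y * finsler_inner F x y u u - (finsler_inner F x y y u)\<^sup>2
    = 2 * (r (x$1))\<^sup>2 * D (x$1) (y$1) (y$2) ^ 3 / (b ^ 4 * (y$1) ^ 6) * (y$1 * u$2 - y$2 * u$1)\<^sup>2"
  unfolding finsler_inner_eq[OF assms] det_g[OF admissible_if_in_C[OF assms], symmetric] by algebra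

text \<open>
  The matrix \<open>g R\<close> is symmetric and annihilates \<open>(p, q)\<close>, as the flagpole has no
  curvature of its own. It is therefore a multiple of the square of the linear form
  \<open>u \<mapsto> p u\<^sub>2 - q u\<^sub>1\<close>.
\<close>
lemma lowered_curvature:
  assumes "admissible s p"
  shows "g11 s p q * R11 s p q + g12 s p q * R21 s p q = - 6 * a * (k * r s * q\<^sup>2)\<^sup>2 / (b\<^sup>2 * D s p q)"
    and "g11 s p q * R12 s p q + g12 s p q * R22 s p q = 6 * a * (k * r s)\<^sup>2 * p * q ^ 3 / (b\<^sup>2 * D s p q)"
    and "g12 s p q * R11 s p q + g22 s p q * R21 s p q = 6 * a * (k * r s)\<^sup>2 * p * q ^ 3 / (b\<^sup>2 * D s p q)"
    and "g12 s p q * R12 s p q + g22 s p q * R22 s p q = - 6 * a * (k * r s * p * q)\<^sup>2 / (b\<^sup>2 * D s p q)"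
  unfolding g11_def g12_def g22_def R11_def R12_def R21_def R22_def
  by (simp add: admissible_nonzero[OF assms] divide_simps; (unfold D_def)?; algebra)+

lemma curvature_form:
  assumes "(x, y) \<in> C"
  shows "finsler_inner F x y (riemann_curvature F x y *v u) u
    = - 6 * a * (k * r (x$1) * y$2)\<^sup>2 / (b\<^sup>2 * D (x$1) (y$1) (y$2)) * (y$1 * u$2 - y$2 * u$1)\<^sup>2"
proof -
  let ?s = "x$1" and ?p = "y$1" and ?q = "y$2"
  have "finsler_inner F x y (riemann_curvature F x y *v u) u =
      (g11 ?s ?p ?q * R11 ?s ?p ?q + g12 ?s ?p ?q * R21 ?s ?p ?q) * (u$1)\<^sup>2
    + ((g11 ?s ?p ?q * R12 ?s ?p ?q + g12 ?s ?p ?q * R22 ?s ?p ?q)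
      + (g12 ?s ?p ?q * R11 ?s ?p ?q + g22 ?s ?p ?q * R21 ?s ?p ?q)) * (u$1 * u$2)
    + (g12 ?s ?p ?q * R12 ?s ?p ?q + g22 ?s ?p ?q * R22 ?s ?p ?q) * (u$2)\<^sup>2"
    unfolding finsler_inner_eq[OF assms]
    by (simp add: matrix_vector_mult_def sum_2 riemann_curvature_eq[OF assms] power2_eq_square algebra_simps)
  also have "\<dots> = - 6 * a * (k * r ?s * ?q)\<^sup>2 / (b\<^sup>2 * D ?s ?p ?q) * (?p * u$2 - ?q * u$1)\<^sup>2"
    unfolding lowered_curvature[OF admissible_if_in_C[OF assms]]
    using admissible_nonzero(3,4)[OF admissible_if_in_C[OF assms]]
      admissible_nonzero(6)[OF admissible_if_in_C[OF assms], of ?q]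
    by (simp add: divide_simps) algebra
  finally show ?thesis .
qed

lemma curvature_form_nonpos:
  assumes "(x, y) \<in> C"
  shows "finsler_inner F x y (riemann_curvature F x y *v u) u \<le> 0"
proof -
  have "0 \<le> 6 * a * (k * r (x$1) * y$2)\<^sup>2 / (b\<^sup>2 * D (x$1) (y$1) (y$2)) * (y$1 * u$2 - y$2 * u$1)\<^sup>2"
    using a_pos admissible_nonzero(5)[OF admissible_if_in_C[OF assms], of "y$2"]
    by (intro mult_nonneg_nonneg divide_nonneg_nonneg) auto
  then show ?thesis unfolding curvature_form[OF assms] by simp
qed

lemma flag_curvature_nonpos:
  assumes "(x, y) \<in> C"
  shows "flag_curvature F x y u \<le> 0"
proof -
  have "0 \<le> 2 * (r (x$1))\<^sup>2 * D (x$1) (y$1) (y$2) ^ 3 / (b ^ 4 * (y$1) ^ 6) * (y$1 * u$2 - y$2 * u$1)\<^sup>2"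
    using admissible_nonzero(5)[OF admissible_if_in_C[OF assms], of "y$2"] by simp
  then show ?thesis
    unfolding flag_curvature_def cauchy_schwarz_deficit[OF assms]
    using curvature_form_nonpos[OF assms, of u] by (rule divide_nonpos_nonneg[rotated])
qed

section \<open>Geodesics and conjugate points of the cone\<close>

text \<open>
  The product rule for \<open>g\<close> along a geodesic: the derivatives of the entries of \<open>g\<close> supply exactly
  the terms that turn ordinary derivatives of the fields into covariant ones.
\<close>
lemma finsler_inner_along_geodesic:
  assumes "\<alpha> < \<beta>" and geo: "geodesic_on F C {\<alpha>..\<beta>} \<gamma>" and t: "t \<in> {\<alpha>..\<beta>}"
    and X: "X differentiable_on {\<alpha>..\<beta>}" and Y: "Y differentiable_on {\<alpha>..\<beta>}"
  shows "((\<lambda>t. finsler_inner F (\<gamma> t) (velocity {\<alpha>..\<beta>} \<gamma> t) (X t) (Y t)) has_real_derivative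
        finsler_inner F (\<gamma> t) (velocity {\<alpha>..\<beta>} \<gamma> t) (cov_deriv_along F {\<alpha>..\<beta>} \<gamma> X t) (Y t)
        + finsler_inner F (\<gamma> t) (velocity {\<alpha>..\<beta>} \<gamma> t) (X t) (cov_deriv_along F {\<alpha>..\<beta>} \<gamma> Y t))
      (at t within {\<alpha>..\<beta>})"
proof -
  let ?I = "{\<alpha>..\<beta>}"
  define V where "V = velocity ?I \<gamma>"
  have comp: "((\<lambda>t. Z t $ i) has_real_derivative vector_derivative Z (at t within ?I) $ i) (at t within ?I)"
    if "Z differentiable_on ?I" for Z :: "real \<Rightarrow> real^2" and i
  proof -
    have "(Z has_vector_derivative vector_derivative Z (at t within ?I)) (at t within ?I)"
      using that t by (simp add: differentiable_on_def vector_derivative_works)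
    then show ?thesis
      unfolding has_real_derivative_iff_has_vector_derivative
      by (rule bounded_linear.has_vector_derivative[OF bounded_linear_vec_nth])
  qed
  have inC: "(\<gamma> t, V t) \<in> C" if "t \<in> ?I" for t
    using geo that by (auto simp: geodesic_on_def V_def)
  note inCt = inC[OF t] and dm = admissible_if_in_C[OF inC[OF t]]
  have diff: "\<gamma> differentiable_on ?I" "V differentiable_on ?I"
    using geo by (auto simp: geodesic_on_def V_def)
  have V': "vector_derivative V (at t within ?I) = - 2 *\<^sub>R spray F (\<gamma> t) (V t)"
    using geo t by (auto simp: geodesic_on_def velocity_def[of _ V] V_def[symmetric] eq_neg_iff_add_eq_0)
  have d\<gamma>: "((\<lambda>t. \<gamma> t $ 1) has_real_derivative V t $ 1) (at t within ?I)"
    using comp[OF diff(1), of 1] by (simp add: V_def velocity_def)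
  have dV: "((\<lambda>t. V t $ 1) has_real_derivative - 2 * G1 (\<gamma> t $ 1) (V t $ 1) (V t $ 2)) (at t within ?I)"
    "((\<lambda>t. V t $ 2) has_real_derivative - 2 * G2 (\<gamma> t $ 1) (V t $ 1) (V t $ 2)) (at t within ?I)"
    using comp[OF diff(2), of 1] comp[OF diff(2), of 2] by (simp_all add: V' spray_eq[OF inCt])
  note dg = g_along_geodesic[of "\<lambda>t. \<gamma> t $ 1" t "\<lambda>t. V t $ 1" ?I "\<lambda>t. V t $ 2", OF dm d\<gamma> dV]
  have cov: "((\<lambda>t. Z t $ i) has_real_derivative (cov_deriv_along F ?I \<gamma> Z t
        - nonlinear_connection F (\<gamma> t) (V t) *v Z t) $ i) (at t within ?I)"
    if "Z differentiable_on ?I" for Z i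
    using comp[OF that, of i] by (simp add: cov_deriv_along_def V_def)
  have "((\<lambda>t. g11 (\<gamma> t $ 1) (V t $ 1) (V t $ 2) * X t $ 1 * Y t $ 1
      + g12 (\<gamma> t $ 1) (V t $ 1) (V t $ 2) * (X t $ 1 * Y t $ 2 + X t $ 2 * Y t $ 1)
      + g22 (\<gamma> t $ 1) (V t $ 1) (V t $ 2) * X t $ 2 * Y t $ 2) has_real_derivative
      finsler_inner F (\<gamma> t) (V t) (cov_deriv_along F ?I \<gamma> X t) (Y t)
        + finsler_inner F (\<gamma> t) (V t) (X t) (cov_deriv_along F ?I \<gamma> Y t)) (at t within ?I)"
    unfolding finsler_inner_eq[OF inCt]
    by (rule DERIV_cong, (rule dg cov[OF X] cov[OF Y] derivative_eq_intros refl)+)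
      (simp add: matrix_vector_mult_def sum_2 nonlinear_connection_eq[OF inCt] algebra_simps)
  then show ?thesis
    unfolding V_def[symmetric] has_field_derivative_def
    by (rule has_derivative_transform[OF t, rotated]) (simp add: finsler_inner_eq[OF inC])
qed

lemma no_forward_conjugate_points: "\<not> forward_conjugate F C p q"
proof (rule no_forward_conjugate_points_if_curvature_nonpos)
  show "finsler_inner F x y u v = finsler_inner F x y v u" if "(x, y) \<in> C" for x y u v
    by (simp add: finsler_inner_eq[OF that] algebra_simps)
qed (fact finsler_inner_pos curvature_form_nonpos finsler_inner_along_geodesic)+

end

section \<open>The cone in hyperbolic space\<close>

lemma cone_map_has_derivative:
  "(cone_map c has_derivative (\<lambda>y. vector
     [y$1 / sqrt 2 * cos (x$2) - profile c (x$1) * sin (x$2) * y$2,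
      y$1 / sqrt 2 * sin (x$2) + profile c (x$1) * cos (x$2) * y$2, y$1])) (at x)"
proof -
  have nth: "((\<lambda>x. x $ i) has_derivative (\<lambda>y. y $ i)) (at x)" for i and x :: "real^2"
    by (rule bounded_linear_imp_has_derivative[OF bounded_linear_vec_nth])
  have "((\<lambda>x. profile c (x$1)) has_derivative (\<lambda>y. y$1 / sqrt 2)) (at x)"
    unfolding profile_def by (auto intro!: derivative_eq_intros nth simp: fun_eq_iff field_simps)
  note rules = this nth
  show ?thesis
    unfolding has_derivative_componentwise_within[of "cone_map c"] cone_map_def
    by (auto simp: Basis_vec_def inner_axis forall_3 UNIV_3 algebra_simps
        intro!: derivative_eq_intros rules)
qed

lemma pullback_cone_map:
  "pullback (cone_map c) T x y = T (cone_map c x) (vector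
     [y$1 / sqrt 2 * cos (x$2) - profile c (x$1) * sin (x$2) * y$2,
      y$1 / sqrt 2 * sin (x$2) + profile c (x$1) * cos (x$2) * y$2, y$1])"
  unfolding pullback_def frechet_derivative_at[OF cone_map_has_derivative, symmetric] by simp

lemma cone_domain_iff:
  "(x, y) \<in> cone_domain b c \<longleftrightarrow> x$1 > 0 \<and> profile c (x$1) > 0 \<and> b * y$1 > 0"
  by (auto simp: cone_domain_def kropina_domain_def cone_params_def hyp3_def pullback_cone_map
      hyp_beta_def cone_map_def zero_less_divide_iff)

lemma open_cone_domain: "open (cone_domain b c)"
proof -
  have "cone_domain b c = {z. fst z $ 1 > 0 \<and> profile c (fst z $ 1) > 0 \<and> b * snd z $ 1 > 0}"
    by (auto simp: cone_domain_iff)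
  then show ?thesis
    by (auto simp: profile_def intro!: open_Collect_conj open_Collect_less continuous_intros)
qed

text \<open>
  The rotation by the angle drops out of the Euclidean length, leaving \<open>p\<^sup>2 / 2 + r\<^sup>2 q\<^sup>2\<close> for the
  horizontal part, and the squared height in \<open>\<alpha>\<^sup>2\<close> cancels against the one in \<open>\<beta>\<close>.
\<close>
lemma cone_metric_eq:
  assumes "(x, y) \<in> cone_domain b c"
  shows "cone_metric b c x y = (3/2 * (y$1)\<^sup>2 + (profile c (x$1))\<^sup>2 * (y$2)\<^sup>2) / (b * y$1)"
proof -
  have "(y$1 / sqrt 2 * cos (x$2) - profile c (x$1) * sin (x$2) * y$2)\<^sup>2
      + (y$1 / sqrt 2 * sin (x$2) + profile c (x$1) * cos (x$2) * y$2)\<^sup>2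
    = ((y$1 / sqrt 2)\<^sup>2 + (profile c (x$1))\<^sup>2 * (y$2)\<^sup>2) * ((sin (x$2))\<^sup>2 + (cos (x$2))\<^sup>2)"
    by algebra
  then show ?thesis
    using assms by (simp add: cone_metric_def kropina_def pullback_cone_map hyp_alpha_def hyp_beta_def
        cone_map_def cone_domain_iff power_divide)
qed

theorem corollary1p1:
  fixes b c :: real
  assumes "b \<noteq> 0"
  shows "(\<forall>(x, y) \<in> cone_domain b c. \<forall>u. u \<notin> span {y} \<longrightarrow>
            flag_curvature (cone_metric b c) x y u \<le> 0) \<and>
         (\<nexists>p q. forward_conjugate (cone_metric b c) (cone_domain b c) p q)"
proof -
  interpret kropina_cone "cone_metric b c" "cone_domain b c" "3/2" b "1 / sqrt 2" c
    by unfold_locales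
      (auto simp: open_cone_domain cone_domain_iff cone_metric_eq profile_def)
  show ?thesis
    using flag_curvature_nonpos no_forward_conjugate_points by blast
qed

end
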